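(* Let $n\ge 1$, let $P\in\mathbb{C}[x_1,\ldots,x_n]$ be a homogeneous polynomial of degree $4$, and let $F=(F_1,\ldots,F_n):\mathbb{C}^n\to\mathbb{C}^n$ be the polynomial mapping given by $F_i=x_i+\frac{\partial P}{\partial x_i}$ for $i=1,\ldots,n$. If $\operatorname{Jac}(F)$ is a non-zero constant, then each of the polynomials $F_1,\ldots,F_n$ is irreducible as an element of the ring $\mathbb{C}[x_1,\ldots,x_n]$.
   Context: $\operatorname{Jac}(F)=\det\left(\frac{\partial F_i}{\partial x_j}\right)_{i,j=1,\ldots,n}\in\mathbb{C}[x_1,\ldots,x_n]$ denotes the Jacobian determinant of the polynomial mapping $F=(F_1,\ldots,F_n)$. Convention: the zero polynomial is regarded as a homogeneous polynomial of any degree. *)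

theory Defs
  imports
    "HOL-Analysis.Determinants"
    "HOL-Library.Poly_Mapping"
    "HOL-Computational_Algebra.Factorial_Ring"
begin

text \<open>
  \<open>('n, 'a) mpoly\<close> is the polynomial ring over \<open>'a\<close> with one indeterminate for each element of
  the index type \<open>'n\<close>: a polynomial is a finitely supported map from exponent vectors
  \<open>'n \<Rightarrow>\<^sub>0 nat\<close> to coefficients. For finite \<open>'n\<close> this is \<open>'a[x\<^sub>1,\<dots>,x\<^sub>n]\<close> with \<open>n = CARD('n)\<close>.
  The ring operations, and hence \<open>irreducible\<close> and \<open>det\<close>, are the library's.
\<close>

type_synonym ('n, 'a) mpoly = "('n \<Rightarrow>\<^sub>0 nat) \<Rightarrow>\<^sub>0 'a"

definition mpoly_const :: "'a::zero \<Rightarrow> ('n, 'a) mpoly" where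
  "mpoly_const c = Poly_Mapping.single 0 c"

definition mpoly_var :: "'n \<Rightarrow> ('n, 'a::zero_neq_one) mpoly" where
  "mpoly_var i = Poly_Mapping.single (Poly_Mapping.single i 1) 1"

text \<open>
  Termwise formal derivative: \<open>c x\<^sup>m\<close> is sent to \<open>m\<^sub>i c x\<close> to the power \<open>m - e\<^sub>i\<close>. The subtraction of
  exponents is truncated, but only where \<open>m\<^sub>i = 0\<close>, and then the coefficient vanishes.
\<close>

definition mpoly_pderiv :: "'n \<Rightarrow> ('n, 'a::comm_semiring_1) mpoly \<Rightarrow> ('n, 'a) mpoly" where
  "mpoly_pderiv i p =
     (\<Sum>m\<in>Poly_Mapping.keys p.
        Poly_Mapping.single (m - Poly_Mapping.single i 1)
          (of_nat (Poly_Mapping.lookup m i) * Poly_Mapping.lookup p m))"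

lemma lookup_mpoly_pderiv:
  fixes p :: "('n, 'a::comm_semiring_1) mpoly"
  shows "Poly_Mapping.lookup (mpoly_pderiv i p) m =
    of_nat (Suc (Poly_Mapping.lookup m i)) *
      Poly_Mapping.lookup p (m + Poly_Mapping.single i 1)"
proof -
  let ?m' = "m + Poly_Mapping.single i 1"
  let ?f = "\<lambda>k. of_nat (Poly_Mapping.lookup k i) * Poly_Mapping.lookup p k"
  have eq: "k = ?m'"
    if "k - Poly_Mapping.single i 1 = m" "Poly_Mapping.lookup k i \<noteq> 0" for k
  proof (rule poly_mapping_eqI)
    fix j
    show "Poly_Mapping.lookup k j = Poly_Mapping.lookup ?m' j"
      using that(2) unfolding that(1)[symmetric] lookup_add lookup_minus lookup_single when_def
      by (cases "i = j") simp_all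
  qed
  have "Poly_Mapping.lookup (mpoly_pderiv i p) m =
      (\<Sum>k\<in>Poly_Mapping.keys p. ?f k when k - Poly_Mapping.single i 1 = m)"
    by (simp add: mpoly_pderiv_def lookup_sum lookup_single)
  also have "\<dots> = (\<Sum>k\<in>Poly_Mapping.keys p. if k = ?m' then ?f k else 0)"
  proof (rule sum.cong)
    fix k assume "k \<in> Poly_Mapping.keys p"
    show "(?f k when k - Poly_Mapping.single i 1 = m) = (if k = ?m' then ?f k else 0)"
    proof (cases "Poly_Mapping.lookup k i = 0")
      case False
      have "k - Poly_Mapping.single i 1 = m \<longleftrightarrow> k = ?m'"
        using eq[OF _ False] by (metis add_diff_cancel_right')
      then show ?thesis by (simp only: when_def)
    next
      case True
      then show ?thesis by (simp only: of_nat_0 mult_zero_left when_simps if_cancel when_def)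
    qed
  qed simp
  also have "\<dots> = ?f ?m'"
    by (simp only: sum.delta finite_keys in_keys_iff) simp
  finally show ?thesis
    by (simp only: lookup_add lookup_single_eq Suc_eq_plus1)
qed

text \<open>The zero polynomial is homogeneous of every degree.\<close>

definition mpoly_homogeneous :: "nat \<Rightarrow> ('n::finite, 'a::zero) mpoly \<Rightarrow> bool" where
  "mpoly_homogeneous d p \<longleftrightarrow>
     (\<forall>m\<in>Poly_Mapping.keys p. (\<Sum>i\<in>UNIV. Poly_Mapping.lookup m i) = d)"

definition mpoly_Jac :: "('n::finite, 'a::comm_ring_1) mpoly ^ 'n \<Rightarrow> ('n, 'a) mpoly" where
  "mpoly_Jac F = det (\<chi> i j. mpoly_pderiv j (F $ i))"

end

theory Submission
  imports Defs "HOL-Computational_Algebra.Polynomial"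
begin

text \<open>
  Fix \<open>i\<close> and let \<open>H\<close> be the cubic form \<open>\<partial>P/\<partial>x\<^sub>i\<close>, so that \<open>F\<^sub>i = x\<^sub>i + H\<close>. The
  constancy of the Jacobian enters in two ways.

  First, \<open>P\<close> is harmonic. The Hessian of \<open>P\<close> is homogeneous of degree 2, so replacing
  \<open>x\<close> by \<open>t x\<close> shows that \<open>det (I + s Hess P(x))\<close> takes the same value for every complex \<open>s = t\<^sup>2\<close>;
  its derivative at \<open>s = 0\<close>, the trace of the Hessian, therefore vanishes
  (\<open>laplacian_zero_if_jacobian_const\<close>). Hence \<open>H\<close> is harmonic as well. Second, the gradient
  of \<open>F\<^sub>i\<close> is a row of an everywhere invertible matrix and so vanishes nowhere.

  Suppose now that \<open>F\<^sub>i = A B\<close> with non-units \<open>A\<close> and \<open>B\<close>. The linear term \<open>x\<^sub>i\<close> prevents both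
  factors from vanishing at the origin, so let \<open>B(0) \<noteq> 0\<close>. At a point \<open>x\<close> of the hyperplane
  \<open>x\<^sub>i = 0\<close> the factorization reads \<open>A(t x) B(t x) = H(x) t\<^sup>3\<close> in \<open>t\<close>, whence
  \<open>t\<^sup>3\<close> divides \<open>A(t x)\<close>. But \<open>B\<close> has positive degree, and degrees add up to at most 3,
  so \<open>A(t x) = 0\<close> and \<open>H(x) = 0\<close> (\<open>cubic_zero_on_hyperplane\<close>). Consequently
  the gradient of \<open>F\<^sub>i\<close> on the hyperplane has only its \<open>i\<close>-th entry \<open>1 + \<partial>H/\<partial>x\<^sub>i\<close> left. This is 1 plus
  a quadratic form. A nonzero quadratic form would take the value -1 on the hyperplane, so
  \<open>\<partial>H/\<partial>x\<^sub>i\<close> vanishes there.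

  Thus \<open>H\<close> is a harmonic polynomial whose value and normal derivative vanish on the hyperplane
  \<open>x\<^sub>i = 0\<close>. Uniqueness in the Cauchy problem for Laplace's equation, which for polynomials
  is a recursion on coefficients, gives \<open>H = 0\<close> (\<open>harmonic_zero_cauchy_data\<close>). Then \<open>F\<^sub>i = x\<^sub>i\<close>
  would be a product of two factors of positive degree, which is absurd.

  Polynomials are compared throughout by their values, in particular along rays \<open>t \<mapsto> t x\<close>, where
  degrees and divisibility become statements about polynomials in one indeterminate.
\<close>

section \<open>Evaluation of polynomials\<close>

abbreviation coef :: "('n, 'a::zero) mpoly \<Rightarrow> ('n \<Rightarrow>\<^sub>0 nat) \<Rightarrow> 'a" where
  "coef \<equiv> Poly_Mapping.lookup"

text \<open>
  Polynomials and exponent vectors are both finitely supported maps; the two names for the same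
  lookup keep coefficients and exponents apart.
\<close>

abbreviation expo :: "('n \<Rightarrow>\<^sub>0 nat) \<Rightarrow> 'n \<Rightarrow> nat" where
  "expo \<equiv> Poly_Mapping.lookup"

abbreviation unit_expo :: "'n \<Rightarrow> ('n \<Rightarrow>\<^sub>0 nat)" where
  "unit_expo i \<equiv> Poly_Mapping.single i 1"

definition total_expo :: "('n::finite \<Rightarrow>\<^sub>0 nat) \<Rightarrow> nat" where
  "total_expo m = (\<Sum>i\<in>UNIV. expo m i)"

definition monomial_at :: "('n::finite \<Rightarrow> 'a::comm_semiring_1) \<Rightarrow> ('n \<Rightarrow>\<^sub>0 nat) \<Rightarrow> 'a" where
  "monomial_at x m = (\<Prod>i\<in>UNIV. x i ^ expo m i)"

definition eval_at :: "('n::finite \<Rightarrow> 'a::comm_semiring_1) \<Rightarrow> ('n, 'a) mpoly \<Rightarrow> 'a" where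
  "eval_at x p = (\<Sum>m\<in>Poly_Mapping.keys p. coef p m * monomial_at x m)"

lemma monomial_at_zero_expo [simp]: "monomial_at x 0 = 1"
  by (simp add: monomial_at_def)

lemma monomial_at_add: "monomial_at x (m + m') = monomial_at x m * monomial_at x m'"
  by (simp add: monomial_at_def lookup_add power_add prod.distrib)

lemma monomial_at_unit_expo: "monomial_at x (unit_expo i) = x i"
proof -
  have "monomial_at x (unit_expo i) = (\<Prod>j\<in>UNIV. if j = i then x i else 1)"
    unfolding monomial_at_def by (rule prod.cong) (auto simp: lookup_single when_def)
  then show ?thesis by (simp del: One_nat_def)
qed

lemma monomial_at_scale: "monomial_at (\<lambda>i. t * x i) m = t ^ total_expo m * monomial_at x m"
  by (simp add: monomial_at_def total_expo_def power_mult_distrib prod.distrib power_sum)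

lemma monomial_at_origin: "m \<noteq> 0 \<Longrightarrow> monomial_at (\<lambda>i. 0) m = 0"
proof -
  assume "m \<noteq> 0"
  then obtain i where "expo m i \<noteq> 0" by (metis lookup_zero poly_mapping_eqI)
  then show ?thesis unfolding monomial_at_def by (intro prod_zero bexI[of _ i]) (auto simp: zero_power)
qed

lemma eval_at_superset:
  assumes "finite K" "Poly_Mapping.keys p \<subseteq> K"
  shows "eval_at x p = (\<Sum>m\<in>K. coef p m * monomial_at x m)"
  unfolding eval_at_def using assms
  by (intro sum.mono_neutral_left) (auto simp: in_keys_iff)

lemma eval_at_zero [simp]: "eval_at x 0 = 0"
  by (simp add: eval_at_def)

lemma eval_at_single [simp]: "eval_at x (Poly_Mapping.single m c) = c * monomial_at x m"
  by (simp add: eval_at_superset[of "{m}"])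

lemma eval_at_const [simp]: "eval_at x (mpoly_const c) = c"
  by (simp add: mpoly_const_def)

lemma eval_at_var [simp]: "eval_at x (mpoly_var i) = x i"
  by (simp add: mpoly_var_def monomial_at_unit_expo[simplified])

lemma eval_at_one [simp]: "eval_at x 1 = 1"
  using eval_at_single[of x 0 1] by simp

lemma eval_at_add: "eval_at x (p + q) = eval_at x p + eval_at x q"
proof -
  let ?K = "Poly_Mapping.keys p \<union> Poly_Mapping.keys q"
  have "Poly_Mapping.keys (p + q) \<subseteq> ?K" by (rule keys_add)
  then show ?thesis
    by (simp add: eval_at_superset[of ?K] lookup_add distrib_right sum.distrib)
qed

lemma eval_at_sum: "eval_at x (sum f A) = (\<Sum>a\<in>A. eval_at x (f a))"
  by (induction A rule: infinite_finite_induct) (auto simp: eval_at_add)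

lemma sum_of_monomials: "(\<Sum>m\<in>Poly_Mapping.keys p. Poly_Mapping.single m (coef p m)) = p"
proof (rule poly_mapping_eqI)
  fix m
  have "coef (\<Sum>m\<in>Poly_Mapping.keys p. Poly_Mapping.single m (coef p m)) m
      = (\<Sum>k\<in>Poly_Mapping.keys p. if k = m then coef p k else 0)"
    unfolding lookup_sum by (rule sum.cong) (auto simp: lookup_single when_def)
  also have "\<dots> = coef p m" by (simp add: sum.delta in_keys_iff)
  finally show "coef (\<Sum>m\<in>Poly_Mapping.keys p. Poly_Mapping.single m (coef p m)) m = coef p m" .
qed

lemma eval_at_mult: "eval_at x (p * q) = eval_at x p * eval_at x q"
proof -
  have "eval_at x (p * q) =
      eval_at x ((\<Sum>m\<in>Poly_Mapping.keys p. Poly_Mapping.single m (coef p m)) *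
        (\<Sum>m\<in>Poly_Mapping.keys q. Poly_Mapping.single m (coef q m)))"
    by (simp only: sum_of_monomials)
  also have "\<dots> = eval_at x p * eval_at x q"
    unfolding eval_at_def[of x p] eval_at_def[of x q]
    by (simp add: sum_product eval_at_sum mult_single monomial_at_add mult_ac)
  finally show ?thesis .
qed

lemma eval_at_uminus: "eval_at x (- p) = - eval_at x (p :: ('n::finite, 'a::comm_ring_1) mpoly)"
  using eval_at_add[of x p "- p"] by (simp add: eq_neg_iff_add_eq_0 add.commute)

lemma eval_at_diff:
  "eval_at x (p - q) = eval_at x p - eval_at x (q :: ('n::finite, 'a::comm_ring_1) mpoly)"
  using eval_at_add[of x p "- q"] by (simp add: eval_at_uminus)

lemma eval_at_prod: "eval_at x (prod f A) = (\<Prod>a\<in>A. eval_at x (f a))"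
  by (induction A rule: infinite_finite_induct) (auto simp: eval_at_mult)

lemma eval_at_of_int:
  "eval_at x (of_int k :: ('n::finite, 'a::comm_ring_1) mpoly) = of_int k"
proof -
  have nat: "eval_at x (of_nat l :: ('n, 'a) mpoly) = of_nat l" for l
    by (induction l) (auto simp: eval_at_add)
  show ?thesis by (cases k rule: int_diff_cases) (simp add: eval_at_diff nat)
qed

lemma eval_at_det:
  fixes M :: "('n::finite, 'a::comm_ring_1) mpoly ^ 'm ^ 'm"
  shows "eval_at x (det M) = det (\<chi> i j. eval_at x (M $ i $ j))"
  by (simp add: det_def eval_at_sum eval_at_mult eval_at_prod eval_at_of_int)

lemma eval_at_origin: "eval_at (\<lambda>i. 0) p = coef p 0"
proof -
  have "eval_at (\<lambda>i. 0) p = (\<Sum>m\<in>insert 0 (Poly_Mapping.keys p). coef p m * monomial_at (\<lambda>i. 0) m)"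
    by (rule eval_at_superset) auto
  also have "\<dots> = (\<Sum>m\<in>insert 0 (Poly_Mapping.keys p). if m = 0 then coef p m else 0)"
    by (rule sum.cong) (auto simp: monomial_at_origin)
  finally show ?thesis by (simp add: sum.delta)
qed

lemma eval_at_scale_homogeneous:
  assumes "mpoly_homogeneous d p"
  shows "eval_at (\<lambda>i. t * x i) p = t ^ d * eval_at x p"
  using assms unfolding eval_at_def mpoly_homogeneous_def
  by (simp add: monomial_at_scale total_expo_def sum_distrib_left mult_ac)

text \<open>
  Distinct monomials are distinct multiplicative characters, so they are linearly independent by
  Artin's argument: doubling one coordinate in which two exponents differ multiplies the terms by
  different powers of 2, and a suitable combination of the two relations has one term fewer.
\<close>

lemma monomial_functions_independent:
  fixes c :: "('n::finite \<Rightarrow>\<^sub>0 nat) \<Rightarrow> 'a::field_char_0"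
  assumes "finite K" "\<And>x. (\<Sum>m\<in>K. c m * monomial_at x m) = 0" "m \<in> K"
  shows "c m = 0"
  using assms
proof (induction K arbitrary: c m rule: finite_induct)
  case empty
  then show ?case by simp
next
  case (insert m' K)
  have zero_K: "c k = 0" if k: "k \<in> K" for k
  proof -
    obtain j where j: "expo k j \<noteq> expo m' j"
      using insert.hyps(2) k by (metis poly_mapping_eqI)
    have scale: "monomial_at (x(j := 2 * x j)) m = 2 ^ expo m j * monomial_at x m"
      for x :: "'n \<Rightarrow> 'a" and m
    proof -
      have "monomial_at (x(j := 2 * x j)) m =
          (\<Prod>i\<in>UNIV. (if i = j then 2 ^ expo m j else 1) * x i ^ expo m i)"
        unfolding monomial_at_def by (rule prod.cong) (auto simp: power_mult_distrib)
      then show ?thesis by (simp add: prod.distrib monomial_at_def)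
    qed
    have "(\<Sum>m\<in>K. (c m * (2 ^ expo m j - 2 ^ expo m' j)) * monomial_at x m) = 0" for x
    proof -
      have 1: "(\<Sum>m\<in>insert m' K. c m * (2 ^ expo m j * monomial_at x m)) = 0"
        using insert.prems(1)[of "x(j := 2 * x j)"] by (simp only: scale)
      have 2: "2 ^ expo m' j * (\<Sum>m\<in>insert m' K. c m * monomial_at x m) = 0"
        by (simp only: insert.prems(1) mult_zero_right)
      show ?thesis
        using arg_cong2[OF 1 2, of "(-)"] insert.hyps
        by (simp add: algebra_simps sum_distrib_left sum_subtractf)
    qed
    from insert.IH[OF this k] have "c k * (2 ^ expo k j - 2 ^ expo m' j) = 0" .
    moreover have "(2::'a) ^ expo k j \<noteq> 2 ^ expo m' j"
    proof
      assume "(2::'a) ^ expo k j = 2 ^ expo m' j"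
      then have "of_nat (2 ^ expo k j) = (of_nat (2 ^ expo m' j) :: 'a)" by simp
      then have "(2::nat) ^ expo k j = 2 ^ expo m' j" by (simp only: of_nat_eq_iff)
      with j show False by simp
    qed
    ultimately show ?thesis by simp
  qed
  moreover have "c m' = 0"
    using insert.prems(1)[of "\<lambda>i. 1"] insert.hyps zero_K by (simp add: monomial_at_def)
  ultimately show ?case using insert.prems(2) by auto
qed

lemma mpoly_eqI_eval:
  fixes p q :: "('n::finite, 'a::field_char_0) mpoly"
  assumes "\<And>x. eval_at x p = eval_at x q"
  shows "p = q"
proof -
  have "coef (p - q) m = 0" for m
  proof (cases "m \<in> Poly_Mapping.keys (p - q)")
    case True
    show ?thesis
      by (rule monomial_functions_independent[OF _ _ True])
        (use assms in \<open>simp_all add: eval_at_def[symmetric] eval_at_diff\<close>)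
  qed (simp add: in_keys_iff)
  then have "p - q = 0" by (intro poly_mapping_eqI) simp
  then show ?thesis by simp
qed

text \<open>
  On \<open>x\<^sub>i = 0\<close> exactly the monomials free of \<open>x\<^sub>i\<close> survive. This identifies vanishing on the
  hyperplane with the vanishing of the corresponding coefficients.
\<close>

lemma eval_at_hyperplane:
  assumes "x i = 0"
  shows "eval_at x p =
    (\<Sum>m\<in>{m \<in> Poly_Mapping.keys p. expo m i = 0}. coef p m * monomial_at x m)"
proof -
  have "monomial_at x m = 0" if "expo m i \<noteq> 0" for m
    unfolding monomial_at_def using assms that by (intro prod_zero bexI[of _ i]) (auto simp: zero_power)
  then show ?thesis
    unfolding eval_at_def by (intro sum.mono_neutral_right) auto
qed

lemma coef_zero_if_zero_on_hyperplane:
  fixes p :: "('n::finite, 'a::field_char_0) mpoly"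
  assumes zero: "\<And>x. x i = 0 \<Longrightarrow> eval_at x p = 0" and "expo m i = 0"
  shows "coef p m = 0"
proof (cases "m \<in> Poly_Mapping.keys p")
  case True
  let ?K = "{m \<in> Poly_Mapping.keys p. expo m i = 0}"
  have "(\<Sum>m\<in>?K. coef p m * monomial_at x m) = 0" for x
  proof -
    have "monomial_at (x(i := 0)) m = monomial_at x m" if "expo m i = 0" for m
      unfolding monomial_at_def using that by (intro prod.cong) auto
    then have "(\<Sum>m\<in>?K. coef p m * monomial_at x m)
        = (\<Sum>m\<in>?K. coef p m * monomial_at (x(i := 0)) m)"
      by (intro sum.cong) auto
    also have "\<dots> = eval_at (x(i := 0)) p" by (simp add: eval_at_hyperplane[of _ i])
    finally show ?thesis using zero by simp
  qed
  from monomial_functions_independent[OF _ this, of m] show ?thesis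
    using True assms(2) by simp
qed (simp add: in_keys_iff)

section \<open>Restriction to lines and the degrees of factors\<close>

text \<open>
  The univariate polynomial \<open>t \<mapsto> p(t x)\<close>. Its coefficient at \<open>t\<close> to the power \<open>k\<close> is the value at
  \<open>x\<close> of the homogeneous part of \<open>p\<close> of degree \<open>k\<close>.
\<close>

definition ray_poly :: "('n::finite \<Rightarrow> 'a::comm_semiring_1) \<Rightarrow> ('n, 'a) mpoly \<Rightarrow> 'a poly" where
  "ray_poly x p =
     (\<Sum>m\<in>Poly_Mapping.keys p. monom (coef p m * monomial_at x m) (total_expo m))"

lemma poly_ray_poly: "poly (ray_poly x p) t = eval_at (\<lambda>i. t * x i) p"
  by (simp add: ray_poly_def poly_sum poly_monom eval_at_def monomial_at_scale mult_ac)

lemma coeff_ray_poly: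
  "coeff (ray_poly x p) k =
    (\<Sum>m\<in>Poly_Mapping.keys p. if total_expo m = k then coef p m * monomial_at x m else 0)"
  by (simp add: ray_poly_def coeff_sum)

lemma ray_poly_mult:
  fixes p q :: "('n::finite, 'a::field_char_0) mpoly"
  shows "ray_poly x (p * q) = ray_poly x p * ray_poly x q"
  by (subst poly_eq_poly_eq_iff[symmetric]) (simp add: fun_eq_iff poly_ray_poly eval_at_mult)

lemma coeff_ray_poly_0: "coeff (ray_poly x p) 0 = coef p 0"
  using poly_ray_poly[of x p 0] by (simp add: poly_0_coeff_0 eval_at_origin)

lemma coeff_ray_poly_along_line:
  fixes x z :: "'n::finite \<Rightarrow> 'a::comm_ring_1"
  shows "\<exists>r. \<forall>s. poly r s = coeff (ray_poly (\<lambda>i. x i + s * (z i - x i)) p) k"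
proof -
  let ?r = "\<Sum>m\<in>Poly_Mapping.keys p. if total_expo m = k
      then smult (coef p m) (\<Prod>i\<in>UNIV. [:x i, z i - x i:] ^ expo m i) else 0"
  have "poly ?r s = coeff (ray_poly (\<lambda>i. x i + s * (z i - x i)) p) k" for s
    unfolding coeff_ray_poly poly_sum
    by (rule sum.cong) (auto simp: poly_prod monomial_at_def)
  then show ?thesis by blast
qed

text \<open>
  Each factor attains a high degree on some ray, but perhaps on different rays through \<open>x\<close> and \<open>z\<close>.
  Along the line joining \<open>x\<close> and \<open>z\<close> the two coefficients in question are nonzero polynomials in the
  parameter, so at some point of the line both are nonzero, and on the ray through that point
  the degrees add up.
\<close>

lemma ray_degree_sum_le:
  fixes A B :: "('n::finite, 'a::field_char_0) mpoly"
  assumes deg: "\<And>y. degree (ray_poly y (A * B)) \<le> d"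
    and A: "coeff (ray_poly x A) k \<noteq> 0" and B: "coeff (ray_poly z B) l \<noteq> 0"
  shows "k + l \<le> d"
proof -
  define y where "y s = (\<lambda>i. x i + s * (z i - x i))" for s
  have y01: "y 0 = x" "y 1 = z" by (auto simp: y_def)
  obtain r1 where r1: "\<And>s. poly r1 s = coeff (ray_poly (y s) A) k"
    using coeff_ray_poly_along_line[of x z A k] by (auto simp: y_def)
  obtain r2 where r2: "\<And>s. poly r2 s = coeff (ray_poly (y s) B) l"
    using coeff_ray_poly_along_line[of x z B l] by (auto simp: y_def)
  have "r1 \<noteq> 0" using r1[of 0] A y01 by auto
  moreover have "r2 \<noteq> 0" using r2[of 1] B y01 by auto
  ultimately have "r1 * r2 \<noteq> 0" by simp
  then obtain s where "poly (r1 * r2) s \<noteq> 0" using poly_all_0_iff_0 by blast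
  then have s: "coeff (ray_poly (y s) A) k \<noteq> 0" "coeff (ray_poly (y s) B) l \<noteq> 0"
    by (auto simp: r1 r2)
  then have "k + l \<le> degree (ray_poly (y s) A) + degree (ray_poly (y s) B)"
    by (intro add_mono le_degree)
  also have "\<dots> = degree (ray_poly (y s) (A * B))"
    using s unfolding ray_poly_mult by (intro degree_mult_eq[symmetric]) auto
  also have "\<dots> \<le> d" by (rule deg)
  finally show ?thesis .
qed

text \<open>A polynomial that is constant on every ray equals its constant term, and is then zero or a unit.\<close>

lemma nonunit_ray_coeff:
  fixes B :: "('n::finite, 'a::field_char_0) mpoly"
  assumes "B \<noteq> 0" "\<not> B dvd 1"
  shows "\<exists>z. \<exists>l\<ge>1. coeff (ray_poly z B) l \<noteq> 0"
proof (rule ccontr)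
  assume "\<not> ?thesis"
  then have zero: "coeff (ray_poly z B) l = 0" if "l \<ge> 1" for z l
    using that by blast
  define b where "b = coef B 0"
  have "ray_poly z B = [:b:]" for z
    by (rule poly_eqI) (auto simp: coeff_pCons b_def coeff_ray_poly_0 zero split: nat.split)
  then have "eval_at z B = b" for z
    using poly_ray_poly[of z B 1] by simp
  then have B: "B = mpoly_const b" by (intro mpoly_eqI_eval) simp
  with assms(1) have "b \<noteq> 0" by (auto simp: mpoly_const_def)
  then have "1 = B * mpoly_const (1 / b)" by (simp add: B mpoly_const_def mult_single)
  with assms(2) show False by (metis dvdI)
qed

section \<open>Derivatives\<close>

lemma mpoly_pderiv_zero [simp]: "mpoly_pderiv i 0 = 0"
  by (simp add: mpoly_pderiv_def)

lemma mpoly_pderiv_add: "mpoly_pderiv i (p + q) = mpoly_pderiv i p + mpoly_pderiv i q"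
  by (rule poly_mapping_eqI) (simp only: lookup_mpoly_pderiv lookup_add distrib_left)

lemma mpoly_pderiv_sum: "mpoly_pderiv i (sum f A) = (\<Sum>a\<in>A. mpoly_pderiv i (f a))"
  by (induction A rule: infinite_finite_induct) (auto simp: mpoly_pderiv_add)

lemma mpoly_pderiv_var:
  "mpoly_pderiv j (mpoly_var i :: ('n, 'a::comm_semiring_1) mpoly) = (if i = j then 1 else 0)"
  by (simp add: mpoly_pderiv_def mpoly_var_def lookup_single when_def)

lemma mpoly_pderiv_commute:
  "mpoly_pderiv i (mpoly_pderiv j p) = mpoly_pderiv j (mpoly_pderiv i p)"
  by (rule poly_mapping_eqI)
    (cases "i = j"; simp add: lookup_mpoly_pderiv lookup_add lookup_single_not_eq add_ac mult_ac)

lemma homogeneous_pderiv: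
  assumes "mpoly_homogeneous (Suc d) p"
  shows "mpoly_homogeneous d (mpoly_pderiv i p)"
  unfolding mpoly_homogeneous_def
proof
  fix m assume "m \<in> Poly_Mapping.keys (mpoly_pderiv i p)"
  then have "coef p (m + unit_expo i) \<noteq> 0"
    by (auto simp: in_keys_iff lookup_mpoly_pderiv)
  then have "(\<Sum>j\<in>UNIV. expo (m + unit_expo i) j) = Suc d"
    using assms by (auto simp: mpoly_homogeneous_def in_keys_iff)
  moreover have "(\<Sum>j\<in>UNIV. expo (m + unit_expo i) j) = (\<Sum>j\<in>UNIV. expo m j) + 1"
    by (simp add: lookup_add sum.distrib lookup_single when_def)
  ultimately show "(\<Sum>j\<in>UNIV. expo m j) = d" by simp
qed

lemma eval_at_pderiv_zero_on_hyperplane: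
  fixes p :: "('n::finite, 'a::field_char_0) mpoly"
  assumes zero: "\<And>x. x i = 0 \<Longrightarrow> eval_at x p = 0" and "j \<noteq> i" "x i = 0"
  shows "eval_at x (mpoly_pderiv j p) = 0"
proof -
  have "coef (mpoly_pderiv j p) m = 0" if "expo m i = 0" for m
    using coef_zero_if_zero_on_hyperplane[OF zero, of i "m + unit_expo j"] that assms(2)
    by (simp add: lookup_mpoly_pderiv lookup_add lookup_single_not_eq)
  then show ?thesis
    by (simp add: eval_at_hyperplane[of x i, OF assms(3)])
qed

section \<open>Constant Jacobian: harmonicity\<close>

text \<open>
  In the Leibniz expansion a permutation other than the identity moves at least two indices, so
  its product has at least two factors vanishing at \<open>s = 0\<close> and contributes nothing to the derivative.
\<close>

lemma has_field_derivative_det_at_identity: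
  fixes M :: "'a::real_normed_field ^ 'n::finite ^ 'n"
  shows "((\<lambda>s. det (\<chi> i j. (if i = j then 1 else 0) + s * M $ i $ j)) has_field_derivative trace M)
    (at 0)"
proof -
  let ?e = "\<lambda>p s i. (if i = p i then 1 else 0) + s * M $ i $ p i"
  let ?D = "\<lambda>p. of_int (sign p) * (\<Sum>i\<in>UNIV. M $ i $ p i * (\<Prod>j\<in>UNIV - {i}. ?e p 0 j))"
  have "((\<lambda>s. \<Sum>p | p permutes UNIV. of_int (sign p) * (\<Prod>i\<in>UNIV. ?e p s i))
      has_field_derivative (\<Sum>p | p permutes (UNIV::'n set). ?D p)) (at 0)"
    by (intro DERIV_sum DERIV_cmult has_field_derivative_prod)
      (auto intro!: derivative_eq_intros)
  moreover have "(\<Sum>p | p permutes (UNIV::'n set). ?D p) = trace M"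
  proof -
    have "?D p = (if p = id then trace M else 0)" if p: "p permutes (UNIV::'n set)" for p
    proof (cases "p = id")
      case True
      then show ?thesis by (simp add: trace_def sign_id)
    next
      case False
      have "\<exists>j\<in>UNIV - {i}. ?e p 0 j = 0" for i
        \<comment> \<open>a moved index different from \<open>i\<close>\<close>
      proof (cases "p i = i")
        case True
        from False obtain j where "p j \<noteq> j" by (auto simp: fun_eq_iff)
        with True show ?thesis by (intro bexI[of _ j]) auto
      next
        case False
        then have "p (p i) \<noteq> p i" using permutes_inj[OF p] by (auto dest: injD)
        with False show ?thesis by (intro bexI[of _ "p i"]) auto
      qed
      then have "(\<Prod>j\<in>UNIV - {i}. ?e p 0 j) = 0" for i
        by (intro prod_zero) auto
      then show ?thesis using False by (simp only: mult_zero_right sum.neutral_const if_False)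
    qed
    then have "(\<Sum>p | p permutes (UNIV::'n set). ?D p)
        = (\<Sum>p | p permutes (UNIV::'n set). if p = id then trace M else 0)"
      by (intro sum.cong) auto
    then show ?thesis by (simp add: sum.delta finite_permutations permutes_id)
  qed
  ultimately show ?thesis by (simp add: det_def)
qed

lemma trace_zero_if_det_constant:
  fixes M :: "'a::real_normed_field ^ 'n::finite ^ 'n"
  assumes "\<And>s. det (\<chi> i j. (if i = j then 1 else 0) + s * M $ i $ j) = c"
  shows "trace M = 0"
proof (rule DERIV_unique)
  show "((\<lambda>s. det (\<chi> i j. (if i = j then 1 else 0) + s * M $ i $ j)) has_field_derivative trace M)
    (at 0)"
    by (rule has_field_derivative_det_at_identity)
  show "((\<lambda>s. det (\<chi> i j. (if i = j then 1 else 0) + s * M $ i $ j)) has_field_derivative 0) (at 0)"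
    by (simp add: assms)
qed

definition laplacian :: "('n::finite, 'a::comm_semiring_1) mpoly \<Rightarrow> ('n, 'a) mpoly" where
  "laplacian p = (\<Sum>k\<in>UNIV. mpoly_pderiv k (mpoly_pderiv k p))"

lemma laplacian_pderiv: "laplacian (mpoly_pderiv i p) = mpoly_pderiv i (laplacian p)"
proof -
  have "mpoly_pderiv k (mpoly_pderiv k (mpoly_pderiv i p))
      = mpoly_pderiv i (mpoly_pderiv k (mpoly_pderiv k p))" for k
    by (metis mpoly_pderiv_commute)
  then show ?thesis by (simp add: laplacian_def mpoly_pderiv_sum)
qed

text \<open>
  The entries of the Hessian have positive degree \<open>d + 1\<close>, so scaling a point by \<open>t\<close> multiplies the
  Hessian by \<open>t\<close> to the power \<open>d + 1\<close>. Every complex number is such a power, and the determinant of the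
  identity plus any multiple of the Hessian is the same constant.
\<close>

lemma laplacian_zero_if_jacobian_const:
  fixes P :: "('n::finite, complex) mpoly"
  assumes hom: "mpoly_homogeneous (Suc (Suc (Suc d))) P"
    and F: "\<And>i. F $ i = mpoly_var i + mpoly_pderiv i P"
    and jac: "mpoly_Jac F = mpoly_const c"
  shows "laplacian P = 0"
proof (rule mpoly_eqI_eval)
  fix x :: "'n \<Rightarrow> complex"
  define M where "M = (\<chi> i j. eval_at x (mpoly_pderiv j (mpoly_pderiv i P)))"
  have hom2: "mpoly_homogeneous (Suc d) (mpoly_pderiv j (mpoly_pderiv i P))" for i j
    using hom by (intro homogeneous_pderiv)
  have "det (\<chi> i j. (if i = j then 1 else 0) + s * M $ i $ j) = c" for s
  proof -
    define t where "t = rcis (root (Suc d) (cmod s)) (Arg s / of_nat (Suc d))"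
    have t: "t ^ Suc d = s"
      unfolding t_def DeMoivre2 by (simp del: of_nat_Suc power_Suc add: rcis_cmod_Arg)
    have "eval_at (\<lambda>i. t * x i) (mpoly_Jac F) =
        det (\<chi> i j. (if i = j then 1 else 0) + s * M $ i $ j)"
      unfolding mpoly_Jac_def eval_at_det
      by (rule arg_cong[of _ _ det])
        (auto simp: vec_eq_iff F mpoly_pderiv_add mpoly_pderiv_var eval_at_add M_def
          eval_at_scale_homogeneous[OF hom2] t[symmetric])
    then show ?thesis by (simp add: jac)
  qed
  then have "trace M = 0" by (rule trace_zero_if_det_constant)
  then show "eval_at x (laplacian P) = eval_at x 0"
    by (simp add: laplacian_def eval_at_sum trace_def M_def)
qed

text \<open>
  Uniqueness for the Cauchy problem with data on \<open>x\<^sub>i = 0\<close>: coefficients with exponent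
  0 or 1 in \<open>x\<^sub>i\<close> encode the value and the normal derivative there. Laplace's equation
  expresses the second derivative in \<open>x\<^sub>i\<close> by those in the other variables, so it determines a
  coefficient by coefficients whose exponent in \<open>x\<^sub>i\<close> is smaller by 2.
\<close>

lemma harmonic_zero_cauchy_data:
  fixes Q :: "('n::finite, 'a::field_char_0) mpoly"
  assumes harm: "laplacian Q = 0"
    and data: "\<And>m. expo m i < 2 \<Longrightarrow> coef Q m = 0"
  shows "Q = 0"
proof -
  have "coef Q m = 0" for m
  proof (induction "expo m i" arbitrary: m rule: less_induct)
    case less
    show ?case
    proof (cases "expo m i < 2")
      case True
      then show ?thesis by (rule data)
    next
      case False
      define u where "u = m - unit_expo i - unit_expo i"
      have m: "u + unit_expo i + unit_expo i = m"
        using False unfolding u_def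
        by (intro poly_mapping_eqI) (auto simp: lookup_add lookup_minus lookup_single when_def)
      have "coef Q (u + unit_expo k + unit_expo k) = 0" if "k \<noteq> i" for k
        using that by (intro less) (simp add: m[symmetric] lookup_add lookup_single_not_eq)
      then have "coef (mpoly_pderiv k (mpoly_pderiv k Q)) u = 0" if "k \<noteq> i" for k
        using that by (simp add: lookup_mpoly_pderiv)
      then have "coef (laplacian Q) u = coef (mpoly_pderiv i (mpoly_pderiv i Q)) u"
        unfolding laplacian_def lookup_sum by (subst sum.remove[of _ i]) auto
      with harm have "coef (mpoly_pderiv i (mpoly_pderiv i Q)) u = 0" by simp
      then have "of_nat (Suc (expo u i)) * (of_nat (Suc (expo (u + unit_expo i) i)) * coef Q m) = 0"
        by (simp only: lookup_mpoly_pderiv m)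
      then show ?thesis by (simp del: of_nat_Suc)
    qed
  qed
  then show ?thesis by (intro poly_mapping_eqI) simp
qed

section \<open>Factorizations of \<open>x\<^sub>i + H\<close>\<close>

lemma ray_poly_var_plus_cubic:
  fixes H :: "('n::finite, 'a::field_char_0) mpoly"
  assumes "mpoly_homogeneous 3 H"
  shows "ray_poly x (mpoly_var i + H) = [:0, x i, 0, eval_at x H:]"
  by (subst poly_eq_poly_eq_iff[symmetric])
    (auto simp: fun_eq_iff poly_ray_poly eval_at_add eval_at_scale_homogeneous[OF assms]
      power3_eq_cube algebra_simps)

text \<open>
  The product of the ray polynomials is a multiple of \<open>t\<^sup>3\<close>, and the one of \<open>B\<close> has a nonzero
  constant term. So \<open>t\<^sup>3\<close> divides the ray polynomial of \<open>A\<close>, and if this is nonzero, \<open>A\<close> has degree at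
  least 3, too much for a non-constant \<open>B\<close> to fit beside it.
\<close>

lemma cubic_zero_on_hyperplane_if_coef_nonzero:
  fixes H A B :: "('n::finite, 'a::field_char_0) mpoly"
  assumes hom: "mpoly_homogeneous 3 H"
    and AB: "mpoly_var i + H = A * B"
    and B: "B \<noteq> 0" "\<not> B dvd 1" "coef B 0 \<noteq> 0" and x: "x i = 0"
  shows "eval_at x H = 0"
proof (rule ccontr)
  assume H: "eval_at x H \<noteq> 0"
  let ?a = "ray_poly x A" and ?b = "ray_poly x B"
  have ab: "?a * ?b = [:0, 0, 0, eval_at x H:]"
    using ray_poly_var_plus_cubic[OF hom, of x i] by (simp add: AB ray_poly_mult x)
  have b0: "coeff ?b 0 \<noteq> 0" using B(3) by (simp add: coeff_ray_poly_0)
  have ab_coeff: "coeff (?a * ?b) n = 0" if "n < 3" for n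
    using that unfolding ab by (auto simp: coeff_pCons split: nat.splits)
  have a_coeff: "coeff ?a n = 0" if "n < 3" for n
    using that
  proof (induction n rule: less_induct)
    case (less n)
    have "coeff (?a * ?b) n = (\<Sum>k\<le>n. coeff ?a k * coeff ?b (n - k))" by (rule coeff_mult)
    also have "\<dots> = (\<Sum>k\<in>{n}. coeff ?a k * coeff ?b (n - k))"
      using less by (intro sum.mono_neutral_right) auto
    finally show ?case using ab_coeff[OF less.prems] b0 by simp
  qed
  from ab H have "?a \<noteq> 0" by auto
  then obtain k where k: "coeff ?a k \<noteq> 0" by (metis leading_coeff_0_iff)
  then have "k \<ge> 3" using a_coeff by (meson not_le)
  obtain z l where l: "l \<ge> 1" "coeff (ray_poly z B) l \<noteq> 0"
    using nonunit_ray_coeff[OF B(1,2)] by blast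
  have "degree (ray_poly y (A * B)) \<le> 3" for y
    unfolding AB[symmetric] ray_poly_var_plus_cubic[OF hom] by simp
  from ray_degree_sum_le[OF this k l(2)] \<open>k \<ge> 3\<close> l(1) show False by simp
qed

text \<open>
  If both factors vanished at the origin, their product would have no linear term; so one
  of them does not, and the roles of the factors may be chosen accordingly.
\<close>

lemma cubic_zero_on_hyperplane:
  fixes H A B :: "('n::finite, 'a::field_char_0) mpoly"
  assumes hom: "mpoly_homogeneous 3 H"
    and AB: "mpoly_var i + H = A * B"
    and nz: "A \<noteq> 0" "B \<noteq> 0" and nonunit: "\<not> A dvd 1" "\<not> B dvd 1" and x: "x i = 0"
  shows "eval_at x H = 0"
proof (cases "coef B 0 = 0")
  case False
  with assms show ?thesis by (intro cubic_zero_on_hyperplane_if_coef_nonzero[of H i A B])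
next
  case True
  have "coef A 0 \<noteq> 0"
  proof
    assume A0: "coef A 0 = 0"
    \<comment> \<open>any point off the hyperplane detects the linear term\<close>
    let ?e = "\<lambda>j::'n. 1 :: 'a"
    have "coeff (ray_poly ?e (A * B)) 1 = 0"
      by (simp add: ray_poly_mult coeff_mult coeff_ray_poly_0 True A0)
    then show False
      unfolding AB[symmetric] ray_poly_var_plus_cubic[OF hom] by simp
  qed
  with assms show ?thesis
    by (intro cubic_zero_on_hyperplane_if_coef_nonzero[of H i B A]) (auto simp: mult.commute)
qed

theorem theorem2p2:
  fixes P :: "('n::finite, complex) mpoly"
    and F :: "('n, complex) mpoly ^ 'n"
  assumes "mpoly_homogeneous 4 P"
    and "\<And>i. F $ i = mpoly_var i + mpoly_pderiv i P"
    and "\<exists>c. c \<noteq> 0 \<and> mpoly_Jac F = mpoly_const c"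
  shows "\<forall>i. irreducible (F $ i)"
proof
  fix i
  define H where "H = mpoly_pderiv i P"
  have hom4: "mpoly_homogeneous (Suc (Suc (Suc 1))) P" using assms(1) by (simp add: numeral_eq_Suc)
  have hom3: "mpoly_homogeneous 3 H"
    using homogeneous_pderiv[OF hom4, of i] by (simp add: H_def numeral_eq_Suc)
  have hom2: "mpoly_homogeneous 2 (mpoly_pderiv i H)"
    using homogeneous_pderiv[of 2 H i] hom3 by (simp add: numeral_eq_Suc)
  have F: "F $ i = mpoly_var i + H" by (simp add: assms(2) H_def)
  obtain c where c: "c \<noteq> 0" "mpoly_Jac F = mpoly_const c" using assms(3) by blast
  have ray: "ray_poly x (F $ i) = [:0, x i, 0, eval_at x H:]" for x
    unfolding F by (rule ray_poly_var_plus_cubic[OF hom3])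
  have nz: "F $ i \<noteq> 0"
    using ray[of "\<lambda>j. 1"] by (auto simp: ray_poly_def)
  have nonunit: "\<not> F $ i dvd 1"
  proof
    assume "F $ i dvd 1"
    then obtain G where "1 = F $ i * G" by (auto elim: dvdE)
    then have "eval_at (\<lambda>j. 0) (1 :: ('n, complex) mpoly) = eval_at (\<lambda>j. 0) (F $ i) * eval_at (\<lambda>j. 0) G"
      by (metis eval_at_mult)
    moreover have "eval_at (\<lambda>j. 0) (F $ i) = 0"
      using poly_ray_poly[of "\<lambda>j. 0" "F $ i" 0] by (simp add: ray)
    ultimately show False by simp
  qed
  have "A dvd 1 \<or> B dvd 1" if AB: "F $ i = A * B" for A B
  proof (rule ccontr)
    assume "\<not> (A dvd 1 \<or> B dvd 1)"
    then have units: "\<not> A dvd 1" "\<not> B dvd 1" by auto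
    have AB0: "A \<noteq> 0" "B \<noteq> 0" using nz AB by auto
    have H0: "eval_at x H = 0" if "x i = 0" for x
      using cubic_zero_on_hyperplane[OF hom3, of i A B x] F AB AB0 units that by simp
    have dH0: "eval_at x (mpoly_pderiv i H) = 0" if x: "x i = 0" for x
    proof (rule ccontr)
      let ?q = "eval_at x (mpoly_pderiv i H)"
      assume q: "?q \<noteq> 0"
      \<comment> \<open>some multiple \<open>y\<close> of \<open>x\<close> brings the quadratic form to -1, and there the gradient vanishes\<close>
      define t where "t = csqrt (- 1 / ?q)"
      define y where "y = (\<lambda>j. t * x j)"
      have y: "y i = 0" by (simp add: y_def x)
      have "t\<^sup>2 * ?q = -1" using q by (simp add: t_def)
      then have "eval_at y (mpoly_pderiv i H) = -1"
        unfolding y_def by (simp add: eval_at_scale_homogeneous[OF hom2])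
      then have row: "eval_at y (mpoly_pderiv j (F $ i)) = 0" for j
        using eval_at_pderiv_zero_on_hyperplane[OF H0, of i j y] y
        by (cases "j = i") (auto simp: F mpoly_pderiv_add mpoly_pderiv_var eval_at_add)
      have "det (\<chi> k j. eval_at y (mpoly_pderiv j (F $ k))) = 0"
        by (rule det_zero_row(1)[of i]) (simp add: row row_def vec_eq_iff)
      then have "eval_at y (mpoly_Jac F) = 0" by (simp add: mpoly_Jac_def eval_at_det)
      with c show False by simp
    qed
    have "H = 0"
    proof (rule harmonic_zero_cauchy_data)
      show "laplacian H = 0"
        unfolding H_def laplacian_pderiv
        by (simp add: laplacian_zero_if_jacobian_const[OF hom4 assms(2) c(2)])
      fix m :: "'n \<Rightarrow>\<^sub>0 nat" assume "expo m i < 2"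
      then consider "expo m i = 0" | "expo m i = 1" by linarith
      then show "coef H m = 0"
      proof cases
        case 1
        then show ?thesis by (intro coef_zero_if_zero_on_hyperplane[OF H0])
      next
        case 2
        define u where "u = m - unit_expo i"
        have m: "u + unit_expo i = m"
          using 2 unfolding u_def
          by (intro poly_mapping_eqI) (auto simp: lookup_add lookup_minus lookup_single when_def)
        have "expo u i = 0" using 2 by (simp add: u_def lookup_minus)
        then have "coef (mpoly_pderiv i H) u = 0"
          by (intro coef_zero_if_zero_on_hyperplane[OF dH0])
        then show ?thesis by (simp add: lookup_mpoly_pderiv m[simplified] \<open>expo u i = 0\<close>)
      qed
    qed
    \<comment> \<open>what is left is the factorization \<open>x\<^sub>i = A B\<close>, excluded by degrees\<close>
    obtain x k where k: "k \<ge> 1" "coeff (ray_poly x A) k \<noteq> 0"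
      using nonunit_ray_coeff[OF AB0(1) units(1)] by blast
    obtain z l where l: "l \<ge> 1" "coeff (ray_poly z B) l \<noteq> 0"
      using nonunit_ray_coeff[OF AB0(2) units(2)] by blast
    have "degree (ray_poly y (A * B)) \<le> 1" for y
      unfolding AB[symmetric] ray by (simp add: \<open>H = 0\<close>)
    from ray_degree_sum_le[OF this k(2) l(2)] k(1) l(1) show False by simp
  qed
  with nz nonunit show "irreducible (F $ i)" by (auto simp: irreducible_def)
qed

end
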